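(* Let $\mathcal E\subset J^r\pi$ be a regular PDE, let $\Phi^{(r)}:\mathcal U\subset J^r\pi\to\mathcal U'\subset J^r\pi'$ be a hodograph $k$-contact transformation, and let $\mathcal E'=\Phi^{(r)}(\mathcal E\cap\mathcal U)\subset J^r\pi'$ be the hodograph transform of $\mathcal E$. If $\phi:U\to E$ is a solution of $\mathcal E$, $j^r\phi(U)\subset\mathcal U$, and $\Phi^{(r)}(j^r\phi(U))$ is transverse to $\pi'_r$, then there exists a local section $\phi':U'\to E'$ solving $\mathcal E'$ and satisfying $$\Phi^{(r)}(j^r\phi(U))=j^r\phi'(U').$$
   Context: $\pi:E\to Q$, $\pi':E'\to Q'$ are fibred manifolds with $\dim Q=\dim Q'=n$ and the same fibre rank $m$; $r\ge1$. $J^r\pi$ is the $r$-th jet bundle, $\pi_r:J^r\pi\to Q$ the projection, $\mathcal C^r_\pi$ its Cartan distribution (locally the common kernel of $\theta^\alpha_I=du^\alpha_I-\sum_iu^\alpha_{I+\widehat e_i}dx^i$, $|I|\le r-1$). A PDE of order $r$ is a regular embedded submanifold $\mathcal E\subset J^r\pi$, regular if $T\mathcal E\cap\mathcal C^r_\pi$ has constant rank. A solution is a local section $\phi:U\subset Q\to E$ with $j^r\phi(U)\subset\mathcal E$. Transversality of an $n$-dimensional submanifold $L\subset J^r\pi'$ to $\pi'_r$ means $TL\cap\ker T\pi'_r=0$; as usual for sections, statements on images of sections are local. A hodograph-type transformation from $\pi$ to $\pi'$ is a local diffeomorphism $\Phi_0:E\to E'$ sending local graphs of sections of $\pi$, whenever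 their images are transverse to $\pi'$, into local graphs of sections of $\pi'$. Its $r$-th hodograph prolongation sends $j^r_x\phi$ (where $\Phi_0(\phi(U))$ is transverse to $\pi'$) to $j^r_{x'}\phi'$, where $\phi'$ is the local section of $\pi'$ whose image is locally $\Phi_0(\phi(U))$ and $x'=\pi'(\Phi_0(\phi(x)))$. A hodograph $k$-contact transformation is a local diffeomorphism $\Phi^{(r)}:\mathcal U\subset J^r\pi\to\mathcal U'\subset J^r\pi'$ between open subsets with $T\Phi^{(r)}(\mathcal C^r_\pi)=\mathcal C^r_{\pi'}$ and which arises locally from a hodograph-type change of variables in this way. If $\Phi^{(r)}(\mathcal E\cap\mathcal U)$ is a regular embedded submanifold of $J^r\pi'$, it is called the hodograph transform of $\mathcal E$. *)

theory Defs
  imports "HOL-Analysis.Analysis"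
begin

section \<open>Smooth functions between Euclidean spaces\<close>

fun Ck_on :: "nat \<Rightarrow> 'a::euclidean_space set \<Rightarrow> ('a \<Rightarrow> 'b::euclidean_space) \<Rightarrow> bool" where
  "Ck_on 0 S f \<longleftrightarrow> continuous_on S f"
| "Ck_on (Suc k) S f \<longleftrightarrow>
     (\<forall>x\<in>S. f differentiable (at x)) \<and> (\<forall>v. Ck_on k S (\<lambda>x. frechet_derivative f (at x) v))"

definition smooth_on :: "'a::euclidean_space set \<Rightarrow> ('a \<Rightarrow> 'b::euclidean_space) \<Rightarrow> bool" where
  "smooth_on S f \<longleftrightarrow> (\<forall>k. Ck_on k S f)"

definition partial :: "'n \<Rightarrow> (real^'n::finite \<Rightarrow> real) \<Rightarrow> real^'n \<Rightarrow> real" where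
  "partial i f = (\<lambda>x. frechet_derivative f (at x) (axis i 1))"

text \<open>The partial derivative \<open>\<partial>\<^sub>I f\<close>. The order in which the derivatives are taken is chosen by
  \<open>SOME\<close>; it is irrelevant for smooth functions, the only ones to which this is applied.\<close>

definition mixed_partial :: "('n \<Rightarrow> nat) \<Rightarrow> (real^'n::finite \<Rightarrow> real) \<Rightarrow> real^'n \<Rightarrow> real" where
  "mixed_partial I f = foldr partial (SOME is. \<forall>i. count_list is i = I i) f"


section \<open>Smooth manifolds given by atlases\<close>

type_synonym ('a, 'v) chart = "'a set \<times> ('a \<Rightarrow> 'v)"

definition compatible :: "('a, 'v::euclidean_space) chart \<Rightarrow> ('a, 'v) chart \<Rightarrow> bool" where
  "compatible C C' \<longleftrightarrow> (case (C, C') of ((D, c), (D', c')) \<Rightarrow>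
     open (c ` (D \<inter> D')) \<and> open (c' ` (D \<inter> D')) \<and>
     smooth_on (c ` (D \<inter> D')) (c' \<circ> inv_into D c) \<and>
     smooth_on (c' ` (D \<inter> D')) (c \<circ> inv_into D' c'))"

definition smooth_atlas :: "('a, 'v::euclidean_space) chart set \<Rightarrow> bool" where
  "smooth_atlas A \<longleftrightarrow>
     (\<forall>(D, c)\<in>A. inj_on c D \<and> open (c ` D)) \<and> (\<forall>C\<in>A. \<forall>C'\<in>A. compatible C C')"

definition atlas_topology :: "('a, 'v::euclidean_space) chart set \<Rightarrow> 'a topology" where
  "atlas_topology A = topology_generated_by {{p \<in> D. c p \<in> N} | D c N. (D, c) \<in> A \<and> open N}"

abbreviation points :: "('a, 'v::euclidean_space) chart set \<Rightarrow> 'a set" where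
  "points A \<equiv> topspace (atlas_topology A)"

definition smooth_manifold :: "('a, 'v::euclidean_space) chart set \<Rightarrow> bool" where
  "smooth_manifold A \<longleftrightarrow> smooth_atlas A \<and>
     Hausdorff_space (atlas_topology A) \<and> second_countable (atlas_topology A)"

definition maximal_atlas :: "('a, 'v::euclidean_space) chart set \<Rightarrow> ('a, 'v) chart set" where
  "maximal_atlas A = {(D, c). D \<subseteq> points A \<and> inj_on c D \<and> open (c ` D) \<and>
     (\<forall>C'\<in>A. compatible (D, c) C')}"

text \<open>Openness of the chart images below says that \<open>f\<close> is continuous on \<open>S\<close>.\<close>

definition smooth_map ::
  "('a, 'v::euclidean_space) chart set \<Rightarrow> ('b, 'w::euclidean_space) chart set
    \<Rightarrow> 'a set \<Rightarrow> ('a \<Rightarrow> 'b) \<Rightarrow> bool" where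
  "smooth_map A B S f \<longleftrightarrow> openin (atlas_topology A) S \<and> f ` S \<subseteq> points B \<and>
     (\<forall>(D, c)\<in>A. \<forall>(D', c')\<in>B.
        let W = c ` {p \<in> S \<inter> D. f p \<in> D'} in open W \<and> smooth_on W (c' \<circ> f \<circ> inv_into D c))"

definition local_diffeo ::
  "('a, 'v::euclidean_space) chart set \<Rightarrow> ('b, 'w::euclidean_space) chart set
    \<Rightarrow> 'a set \<Rightarrow> ('a \<Rightarrow> 'b) \<Rightarrow> bool" where
  "local_diffeo A B S f \<longleftrightarrow> smooth_map A B S f \<and>
     (\<forall>p\<in>S. \<exists>W. openin (atlas_topology A) W \<and> p \<in> W \<and> W \<subseteq> S \<and> inj_on f W \<and>
        openin (atlas_topology B) (f ` W) \<and> smooth_map B A (f ` W) (inv_into W f))"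


subsection \<open>Tangent vectors\<close>

text \<open>A tangent vector at \<open>p\<close> is the family of its coordinate representations in all charts of the
  atlas around \<open>p\<close> (and \<open>0\<close> at all other charts); tangent vectors arise as velocities of curves.\<close>

type_synonym ('a, 'v) tangent = "('a, 'v) chart \<Rightarrow> 'v"

definition velocity ::
  "('a, 'v::euclidean_space) chart set \<Rightarrow> (real \<Rightarrow> 'a) \<Rightarrow> ('a, 'v) tangent" where
  "velocity A \<gamma> = (\<lambda>C. if C \<in> A \<and> \<gamma> 0 \<in> fst C
     then vector_derivative (snd C \<circ> \<gamma>) (at 0) else 0)"

text \<open>\<open>T\<^sub>p L\<close> for \<open>L = points A\<close> or an embedded submanifold \<open>L\<close>.\<close>

definition tangent_space ::
  "('a, 'v::euclidean_space) chart set \<Rightarrow> 'a set \<Rightarrow> 'a \<Rightarrow> ('a, 'v) tangent set" where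
  "tangent_space A L p = {velocity A \<gamma> | \<gamma> e. 0 < e \<and>
     smooth_map {(UNIV, id)} A {-e<..<e} \<gamma> \<and> \<gamma> 0 = p \<and> \<gamma> ` {-e<..<e} \<subseteq> L}"

definition tangent_map ::
  "('a, 'v::euclidean_space) chart set \<Rightarrow> ('b, 'w::euclidean_space) chart set
    \<Rightarrow> ('a \<Rightarrow> 'b) \<Rightarrow> 'a \<Rightarrow> ('a, 'v) tangent \<Rightarrow> ('b, 'w) tangent" where
  "tangent_map A B f p v = (\<lambda>C'. if C' \<in> B \<and> f p \<in> fst C'
     then let C = (SOME C. C \<in> A \<and> p \<in> fst C)
          in frechet_derivative (snd C' \<circ> f \<circ> inv_into (fst C) (snd C)) (at (snd C p)) (v C)
     else 0)"

definition has_rank ::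
  "('a, 'v::euclidean_space) chart set \<Rightarrow> 'a \<Rightarrow> ('a, 'v) tangent set \<Rightarrow> nat \<Rightarrow> bool" where
  "has_rank A p V k \<longleftrightarrow> (\<forall>C\<in>A. p \<in> fst C \<longrightarrow> dim ((\<lambda>v. v C) ` V) = k)"


subsection \<open>Submanifolds and transversality\<close>

definition embedded_submanifold ::
  "('a, 'v::euclidean_space) chart set \<Rightarrow> nat \<Rightarrow> 'a set \<Rightarrow> bool" where
  "embedded_submanifold A d L \<longleftrightarrow> L \<subseteq> points A \<and>
     (\<forall>p\<in>L. \<exists>(D, c)\<in>maximal_atlas A. p \<in> D \<and>
        (\<exists>S. subspace S \<and> dim S = d \<and> c ` (L \<inter> D) = c ` D \<inter> S))"

text \<open>\<open>L\<close> is a submanifold of the dimension of the base \<open>B\<close>, and \<open>TL \<inter> ker Tf = 0\<close>.\<close>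

definition transverse ::
  "('a, 'v::euclidean_space) chart set \<Rightarrow> ('b, 'w::euclidean_space) chart set
    \<Rightarrow> ('a \<Rightarrow> 'b) \<Rightarrow> 'a set \<Rightarrow> bool" where
  "transverse A B f L \<longleftrightarrow> embedded_submanifold A DIM('w) L \<and>
     (\<forall>p\<in>L. \<forall>v\<in>tangent_space A L p. tangent_map A B f p v = (\<lambda>_. 0) \<longrightarrow> v = (\<lambda>_. 0))"


section \<open>Fibred manifolds\<close>

record ('q, 'e, 'n, 'm) fibred =
  base :: "('q, real^'n::finite) chart set"
  total :: "('e, (real^'n::finite) \<times> (real^'m::finite)) chart set"
  proj :: "'e \<Rightarrow> 'q"

abbreviation base_topology :: "('q, 'e, 'n::finite, 'm::finite) fibred \<Rightarrow> 'q topology" where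
  "base_topology F \<equiv> atlas_topology (base F)"

definition fibred_manifold :: "('q, 'e, 'n::finite, 'm::finite) fibred \<Rightarrow> bool" where
  "fibred_manifold F \<longleftrightarrow> smooth_manifold (base F) \<and> smooth_manifold (total F) \<and>
     smooth_map (total F) (base F) (points (total F)) (proj F) \<and>
     proj F ` points (total F) = points (base F) \<and>
     (\<forall>e\<in>points (total F).
        tangent_map (total F) (base F) (proj F) e ` tangent_space (total F) (points (total F)) e
          = tangent_space (base F) (points (base F)) (proj F e))"

definition local_section ::
  "('q, 'e, 'n::finite, 'm::finite) fibred \<Rightarrow> 'q set \<Rightarrow> ('q \<Rightarrow> 'e) \<Rightarrow> bool" where
  "local_section F U \<phi> \<longleftrightarrow> smooth_map (base F) (total F) U \<phi> \<and> (\<forall>x\<in>U. proj F (\<phi> x) = x)"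

text \<open>Fibred charts \<open>(x\<^sup>i, u\<^sup>\<alpha>)\<close> of the total space, paired with a chart \<open>(x\<^sup>i)\<close> of the base.\<close>

definition fibred_charts ::
  "('q, 'e, 'n::finite, 'm::finite) fibred
    \<Rightarrow> (('e, (real^'n) \<times> (real^'m)) chart \<times> ('q, real^'n) chart) set" where
  "fibred_charts F = {((D, c), (D0, c0)). (D, c) \<in> maximal_atlas (total F) \<and>
     (D0, c0) \<in> maximal_atlas (base F) \<and>
     (\<forall>e\<in>D. proj F e \<in> D0 \<and> fst (c e) = c0 (proj F e))}"

text \<open>\<open>\<partial>\<^sub>I(u\<^sup>\<alpha> \<circ> \<phi>)\<close> at \<open>x\<close> in a fibred chart.\<close>

definition section_partial ::
  "('e, (real^'n::finite) \<times> (real^'m::finite)) chart \<times> ('q, real^'n) chart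
    \<Rightarrow> ('n \<Rightarrow> nat) \<Rightarrow> 'm \<Rightarrow> ('q \<Rightarrow> 'e) \<Rightarrow> 'q \<Rightarrow> real" where
  "section_partial K I \<alpha> \<phi> x = (case K of ((D, c), (D0, c0)) \<Rightarrow>
     mixed_partial I (\<lambda>y. snd (c (\<phi> (inv_into D0 c0 y))) $ \<alpha>) (c0 x))"


section \<open>Jet bundles\<close>

text \<open>The order of the jets is \<open>r = CARD('r) \<ge> 1\<close>, so that the multi-indices \<open>I\<close> with \<open>|I| \<le> r\<close> form a
  finite type and jet coordinates live in a Euclidean space.\<close>

typedef ('n, 'r) multi_index = "{I :: 'n::finite \<Rightarrow> nat. sum I UNIV \<le> CARD('r::finite)}"
  morphisms exponent Multi_Index
  by (rule exI[of _ "\<lambda>_. 0"]) simp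

instance multi_index :: (finite, finite) finite
proof
  have "{I :: 'a \<Rightarrow> nat. sum I UNIV \<le> CARD('b)} \<subseteq> PiE UNIV (\<lambda>_. {..CARD('b)})"
  proof
    fix I :: "'a \<Rightarrow> nat"
    assume "I \<in> {I. sum I UNIV \<le> CARD('b)}"
    moreover have "I i \<le> sum I UNIV" for i
      by (rule member_le_sum) auto
    ultimately have "I i \<le> CARD('b)" for i
      using order_trans by blast
    then show "I \<in> PiE UNIV (\<lambda>_. {..CARD('b)})"
      by auto
  qed
  then have "finite {I :: 'a \<Rightarrow> nat. sum I UNIV \<le> CARD('b)}"
    by (rule finite_subset) (simp add: finite_PiE)
  then have "finite (range (exponent :: ('a, 'b) multi_index \<Rightarrow> _))"
    by (rule rev_finite_subset) (use exponent in auto)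
  then show "finite (UNIV :: ('a, 'b) multi_index set)"
    by (rule finite_imageD) (simp add: exponent_inject inj_on_def)
qed

text \<open>\<open>I + e\<^sub>i\<close>, meaningful when \<open>|I| < r\<close>.\<close>

definition index_succ :: "('n::finite, 'r::finite) multi_index \<Rightarrow> 'n \<Rightarrow> ('n, 'r) multi_index" where
  "index_succ I i = Multi_Index ((exponent I)(i := Suc (exponent I i)))"

type_synonym ('n, 'm, 'r) jet_coords = "(real^'n) \<times> (real^('n, 'r) multi_index^'m)"

text \<open>The jet \<open>j\<^sup>r\<^sub>x\<phi>\<close> is the base point \<open>x\<close> together with the set of all local sections around \<open>x\<close>
  whose partial derivatives up to order \<open>r\<close> at \<open>x\<close> agree with those of \<open>\<phi>\<close>.\<close>

type_synonym ('q, 'e) jet = "'q \<times> ('q set \<times> ('q \<Rightarrow> 'e)) set"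

definition same_jet ::
  "nat \<Rightarrow> ('q, 'e, 'n::finite, 'm::finite) fibred \<Rightarrow> 'q \<Rightarrow> ('q \<Rightarrow> 'e) \<Rightarrow> ('q \<Rightarrow> 'e) \<Rightarrow> bool" where
  "same_jet r F x \<phi> \<psi> \<longleftrightarrow> \<phi> x = \<psi> x \<and>
     (\<forall>K\<in>fibred_charts F. \<phi> x \<in> fst (fst K) \<longrightarrow>
        (\<forall>I \<alpha>. sum I UNIV \<le> r \<longrightarrow> section_partial K I \<alpha> \<phi> x = section_partial K I \<alpha> \<psi> x))"

definition jet ::
  "'r::finite itself \<Rightarrow> ('q, 'e, 'n::finite, 'm::finite) fibred
    \<Rightarrow> ('q \<Rightarrow> 'e) \<Rightarrow> 'q \<Rightarrow> ('q, 'e) jet" where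
  "jet R F \<phi> x = (x, {(V, \<psi>). local_section F V \<psi> \<and> x \<in> V \<and> same_jet CARD('r) F x \<phi> \<psi>})"

definition jet_chart ::
  "('q, 'e, 'n::finite, 'm::finite) fibred
    \<Rightarrow> ('e, (real^'n) \<times> (real^'m)) chart \<times> ('q, real^'n) chart
    \<Rightarrow> (('q, 'e) jet, ('n, 'm, 'r::finite) jet_coords) chart" where
  "jet_chart F K =
     ({jet TYPE('r) F \<phi> x | U \<phi> x. local_section F U \<phi> \<and> x \<in> U \<and> \<phi> x \<in> fst (fst K)},
      \<lambda>j. let \<phi> = snd (SOME s. s \<in> snd j)
          in (snd (snd K) (fst j),
              \<chi> \<alpha> I. section_partial K (exponent I) \<alpha> \<phi> (fst j)))"

text \<open>The jet bundle \<open>J\<^sup>r\<pi>\<close> with its standard coordinates \<open>(x\<^sup>i, u\<^sup>\<alpha>\<^sub>I)\<close>. Its projection to the base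
  is \<open>fst\<close>.\<close>

definition jet_bundle ::
  "'r::finite itself \<Rightarrow> ('q, 'e, 'n::finite, 'm::finite) fibred
    \<Rightarrow> (('q, 'e) jet, ('n, 'm, 'r) jet_coords) chart set" where
  "jet_bundle R F = jet_chart F ` fibred_charts F"

abbreviation jet_topology ::
  "'r::finite itself \<Rightarrow> ('q, 'e, 'n::finite, 'm::finite) fibred \<Rightarrow> ('q, 'e) jet topology" where
  "jet_topology R F \<equiv> atlas_topology (jet_bundle R F)"

text \<open>The common kernel of the forms \<open>du\<^sup>\<alpha>\<^sub>I - (\<Sum>i. u\<^sup>\<alpha>\<^bsub>I + e\<^sub>i\<^esub> dx\<^sup>i)\<close> for \<open>|I| \<le> r - 1\<close>.\<close>

definition cartan ::
  "'r::finite itself \<Rightarrow> ('q, 'e, 'n::finite, 'm::finite) fibred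
    \<Rightarrow> ('q, 'e) jet \<Rightarrow> (('q, 'e) jet, ('n, 'm, 'r) jet_coords) tangent set" where
  "cartan R F p = {v \<in> tangent_space (jet_bundle R F) (points (jet_bundle R F)) p.
     \<forall>C\<in>jet_bundle R F. p \<in> fst C \<longrightarrow>
       (\<forall>\<alpha> I. sum (exponent I) UNIV \<le> CARD('r) - 1 \<longrightarrow>
          snd (v C) $ \<alpha> $ I = (\<Sum>i\<in>UNIV. snd (snd C p) $ \<alpha> $ index_succ I i * fst (v C) $ i))}"


section \<open>Partial differential equations\<close>

definition regular_pde ::
  "'r::finite itself \<Rightarrow> ('q, 'e, 'n::finite, 'm::finite) fibred \<Rightarrow> ('q, 'e) jet set \<Rightarrow> bool" where
  "regular_pde R F \<E> \<longleftrightarrow> (\<exists>d. embedded_submanifold (jet_bundle R F) d \<E>) \<and>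
     (\<exists>k. \<forall>p\<in>\<E>. has_rank (jet_bundle R F) p (tangent_space (jet_bundle R F) \<E> p \<inter> cartan R F p) k)"

definition solution ::
  "'r::finite itself \<Rightarrow> ('q, 'e, 'n::finite, 'm::finite) fibred
    \<Rightarrow> ('q, 'e) jet set \<Rightarrow> 'q set \<Rightarrow> ('q \<Rightarrow> 'e) \<Rightarrow> bool" where
  "solution R F \<E> U \<phi> \<longleftrightarrow> local_section F U \<phi> \<and> jet R F \<phi> ` U \<subseteq> \<E>"


section \<open>Hodograph transformations\<close>

text \<open>The change of variables is defined on an open set \<open>D\<close> of the total space. Images of sections
  are taken locally: the domain \<open>U\<close> may be shrunk around each of its points.\<close>

definition hodograph_type ::
  "('q, 'e, 'n::finite, 'm::finite) fibred \<Rightarrow> ('p, 'd, 'n, 'm) fibred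
    \<Rightarrow> 'e set \<Rightarrow> ('e \<Rightarrow> 'd) \<Rightarrow> bool" where
  "hodograph_type F F' D \<Phi>0 \<longleftrightarrow> local_diffeo (total F) (total F') D \<Phi>0 \<and>
     (\<forall>U \<phi>. local_section F U \<phi> \<and> \<phi> ` U \<subseteq> D \<and>
        transverse (total F') (base F') (proj F') (\<Phi>0 ` \<phi> ` U) \<longrightarrow>
        (\<forall>x\<in>U. \<exists>V U' \<phi>'. openin (base_topology F) V \<and> x \<in> V \<and> V \<subseteq> U \<and>
           local_section F' U' \<phi>' \<and> \<Phi>0 ` \<phi> ` V = \<phi>' ` U'))"

text \<open>On \<open>W\<close>, the map \<open>\<Phi>\<close> coincides with the \<open>r\<close>-th hodograph prolongation of \<open>\<Phi>0\<close>; in particular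
  \<open>W\<close> is contained in the domain of the prolongation.\<close>

definition hodograph_prolongation ::
  "'r::finite itself \<Rightarrow> ('q, 'e, 'n::finite, 'm::finite) fibred \<Rightarrow> ('p, 'd, 'n, 'm) fibred
    \<Rightarrow> 'e set \<Rightarrow> ('e \<Rightarrow> 'd) \<Rightarrow> ('q, 'e) jet set \<Rightarrow> (('q, 'e) jet \<Rightarrow> ('p, 'd) jet) \<Rightarrow> bool" where
  "hodograph_prolongation R F F' D \<Phi>0 W \<Phi> \<longleftrightarrow>
     (\<forall>U \<phi> x. local_section F U \<phi> \<and> x \<in> U \<and> jet R F \<phi> x \<in> W \<longrightarrow>
        (\<exists>V. openin (base_topology F) V \<and> x \<in> V \<and> V \<subseteq> U \<and> \<phi> ` V \<subseteq> D \<and>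
           transverse (total F') (base F') (proj F') (\<Phi>0 ` \<phi> ` V)) \<and>
        (\<forall>V U' \<phi>'. openin (base_topology F) V \<and> x \<in> V \<and> V \<subseteq> U \<and> \<phi> ` V \<subseteq> D \<and>
           local_section F' U' \<phi>' \<and> \<Phi>0 ` \<phi> ` V = \<phi>' ` U' \<longrightarrow>
           \<Phi> (jet R F \<phi> x) = jet R F' \<phi>' (proj F' (\<Phi>0 (\<phi> x)))))"

definition hodograph_contact ::
  "'r::finite itself \<Rightarrow> ('q, 'e, 'n::finite, 'm::finite) fibred \<Rightarrow> ('p, 'd, 'n, 'm) fibred
    \<Rightarrow> ('q, 'e) jet set \<Rightarrow> ('p, 'd) jet set \<Rightarrow> (('q, 'e) jet \<Rightarrow> ('p, 'd) jet) \<Rightarrow> bool" where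
  "hodograph_contact R F F' \<U> \<U>' \<Phi> \<longleftrightarrow>
     openin (jet_topology R F) \<U> \<and> openin (jet_topology R F') \<U>' \<and> \<Phi> ` \<U> \<subseteq> \<U>' \<and>
     local_diffeo (jet_bundle R F) (jet_bundle R F') \<U> \<Phi> \<and>
     (\<forall>p\<in>\<U>. tangent_map (jet_bundle R F) (jet_bundle R F') \<Phi> p ` cartan R F p = cartan R F' (\<Phi> p)) \<and>
     (\<forall>p\<in>\<U>. \<exists>W D \<Phi>0. openin (jet_topology R F) W \<and> p \<in> W \<and> W \<subseteq> \<U> \<and>
        hodograph_type F F' D \<Phi>0 \<and> hodograph_prolongation R F F' D \<Phi>0 W \<Phi>)"

end

theory Submission
  imports Defs
begin

text \<open>Around each jet in \<open>\<U>\<close> the transformation \<open>\<Phi>\<close> is the prolongation of a hodograph-type change of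
  variables \<open>\<Phi>0\<close>. By the very existence of this prolongation, \<open>\<Phi>0\<close> carries the graph of \<open>\<phi>\<close>, locally
  around a given point, to a submanifold transverse to the fibres of \<open>\<pi>'\<close>; because \<open>\<Phi>0\<close> is of
  hodograph type, that submanifold is, after shrinking, the graph of a section \<open>\<phi>'\<close> of \<open>\<pi>'\<close>. The
  prolongation sends the jet of \<open>\<phi>\<close> at \<open>y\<close> to the jet of \<open>\<phi>'\<close> at \<open>\<pi>' (\<Phi>0 (\<phi> y))\<close>, and these points
  run through the whole domain of \<open>\<phi>'\<close>, so \<open>\<Phi>\<close> maps the image of the one jet prolongation onto the
  image of the other. The image lies in \<open>\<E>'\<close> since \<open>\<phi>\<close> solves \<open>\<E>\<close>.

  One \<open>\<Phi>0\<close> must serve for all \<open>y\<close> near the given point, although it represents \<open>\<Phi>\<close> only on an open set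
  of jets. This is where analysis enters: \<open>x \<mapsto> j\<^sup>r\<^sub>x\<phi>\<close> is continuous (\<open>openin_jet_preimage\<close>), so the jets
  of \<open>\<phi>\<close> at all nearby points lie in that set. In jet coordinates the map consists of \<open>x\<^sup>i\<close> and of the
  partial derivatives of \<open>\<phi>\<close> in a fibred chart. Fibred charts are taken from the maximal atlases, whereas
  smoothness of \<open>\<phi>\<close> is given in the charts of the atlases, so continuity of the derivatives rests
  on closure of smooth functions under composition (\<open>Ck_on_compose\<close>) and on the resulting change of
  charts (\<open>smooth_map_in_maximal_charts\<close>).\<close>

section \<open>Calculus of smooth functions\<close>

lemma Ck_on_subset: "Ck_on k S f \<Longrightarrow> T \<subseteq> S \<Longrightarrow> Ck_on k T f"
  by (induction k arbitrary: f) (auto intro: continuous_on_subset)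

lemma Ck_on_SucD: "Ck_on (Suc k) S f \<Longrightarrow> Ck_on k S f"
proof (induction k arbitrary: f)
  case 0
  then show ?case
    by (auto intro!: differentiable_imp_continuous_on differentiable_at_imp_differentiable_on)
qed auto

lemma Ck_on_imp_continuous_on: "Ck_on k S f \<Longrightarrow> continuous_on S f"
  by (induction k) (auto simp del: Ck_on.simps(2) dest: Ck_on_SucD)

lemma frechet_derivative_cong_open:
  assumes "open S" "x \<in> S" "\<And>y. y \<in> S \<Longrightarrow> f y = g y"
  shows "frechet_derivative f (at x) = frechet_derivative g (at x)"
proof -
  have "(f has_derivative D) (at x) \<longleftrightarrow> (g has_derivative D) (at x)" for D
    using assms has_derivative_transform_within_open[of f D x UNIV S g]
      has_derivative_transform_within_open[of g D x UNIV S f] by auto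
  then show ?thesis
    unfolding frechet_derivative_def by simp
qed

lemma Ck_on_cong:
  assumes "open S" "Ck_on k S f" "\<And>x. x \<in> S \<Longrightarrow> f x = g x"
  shows "Ck_on k S g"
  using assms(2,3)
proof (induction k arbitrary: f g)
  case 0
  then show ?case
    using continuous_on_cong[of S S f g] by simp
next
  case (Suc k)
  have "g differentiable (at x)" if x: "x \<in> S" for x
  proof -
    obtain D where "(f has_derivative D) (at x)"
      using Suc.prems(1) x by (auto simp: differentiable_def)
    then have "(g has_derivative D) (at x)"
      by (rule has_derivative_transform_within_open[OF _ assms(1) x]) (use Suc.prems(2) in auto)
    then show ?thesis
      by (auto simp: differentiable_def)
  qed
  moreover have "Ck_on k S (\<lambda>x. frechet_derivative g (at x) v)" for v
  proof (rule Suc.IH)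
    show "Ck_on k S (\<lambda>x. frechet_derivative f (at x) v)"
      using Suc.prems(1) by simp
    show "frechet_derivative f (at x) v = frechet_derivative g (at x) v" if "x \<in> S" for x
      using frechet_derivative_cong_open[OF assms(1) that, of f g] Suc.prems(2) by metis
  qed
  ultimately show ?case by simp
qed

lemma Ck_on_local:
  assumes "\<And>x. x \<in> S \<Longrightarrow> \<exists>T. open T \<and> x \<in> T \<and> Ck_on k T f"
  shows "Ck_on k S f"
  using assms
proof (induction k arbitrary: f)
  case 0
  have "isCont f x" if "x \<in> S" for x
    using 0[OF that] by (auto simp: continuous_on_eq_continuous_at)
  then show ?case
    by (simp add: continuous_at_imp_continuous_on)
next
  case (Suc k)
  have "f differentiable (at x)" if "x \<in> S" for x
    using Suc.prems[OF that] by auto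
  moreover have "Ck_on k S (\<lambda>x. frechet_derivative f (at x) v)" for v
  proof (rule Suc.IH)
    fix x assume "x \<in> S"
    then obtain T where "open T" "x \<in> T" "Ck_on (Suc k) T f"
      using Suc.prems by blast
    then show "\<exists>T. open T \<and> x \<in> T \<and> Ck_on k T (\<lambda>x. frechet_derivative f (at x) v)"
      by (intro exI[of _ T]) simp
  qed
  ultimately show ?case by simp
qed

lemma Ck_on_const: "Ck_on k S (\<lambda>x. c)"
  by (induction k arbitrary: c) (auto simp: frechet_derivative_const)

lemma Ck_on_add:
  assumes "open S" "Ck_on k S f" "Ck_on k S g"
  shows "Ck_on k S (\<lambda>x. f x + g x)"
  using assms(2,3)
proof (induction k arbitrary: f g)
  case 0
  then show ?case by (auto intro: continuous_intros)
next
  case (Suc k)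
  have der: "((\<lambda>x. f x + g x) has_derivative
      (\<lambda>v. frechet_derivative f (at x) v + frechet_derivative g (at x) v)) (at x)"
    if "x \<in> S" for x
    by (rule has_derivative_add)
      (use Suc.prems that in \<open>auto simp: frechet_derivative_works[symmetric]\<close>)
  have "Ck_on k S (\<lambda>x. frechet_derivative f (at x) v + frechet_derivative g (at x) v)" for v
    using Suc.prems by (intro Suc.IH) auto
  then have "Ck_on k S (\<lambda>x. frechet_derivative (\<lambda>x. f x + g x) (at x) v)" for v
    by (rule Ck_on_cong[OF assms(1)]) (simp add: frechet_derivative_at[OF der, symmetric])
  then show ?case
    using der by (auto simp: differentiable_def)
qed

lemma Ck_on_sum:
  assumes "open S" "\<And>i. i \<in> A \<Longrightarrow> Ck_on k S (f i)"
  shows "Ck_on k S (\<lambda>x. \<Sum>i\<in>A. f i x)"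
  using assms(2)
  by (induction A rule: infinite_finite_induct) (auto simp: Ck_on_const intro!: Ck_on_add[OF assms(1)])

lemma Ck_on_scaleR:
  fixes h :: "'a::euclidean_space \<Rightarrow> real" and f :: "'a \<Rightarrow> 'b::euclidean_space"
  assumes "open S" "Ck_on k S h" "Ck_on k S f"
  shows "Ck_on k S (\<lambda>x. h x *\<^sub>R f x)"
  using assms(2,3)
proof (induction k arbitrary: f h)
  case 0
  then show ?case by (auto intro: continuous_intros)
next
  case (Suc k)
  have der: "((\<lambda>x. h x *\<^sub>R f x) has_derivative
      (\<lambda>v. h x *\<^sub>R frechet_derivative f (at x) v + frechet_derivative h (at x) v *\<^sub>R f x)) (at x)"
    if "x \<in> S" for x
    by (rule has_derivative_scaleR)
      (use Suc.prems that in \<open>auto simp: frechet_derivative_works[symmetric]\<close>)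
  have "Ck_on k S (\<lambda>x. h x *\<^sub>R frechet_derivative f (at x) v + frechet_derivative h (at x) v *\<^sub>R f x)" for v
    using Suc.prems Suc.prems[THEN Ck_on_SucD] by (intro Ck_on_add[OF assms(1)] Suc.IH) auto
  then have "Ck_on k S (\<lambda>x. frechet_derivative (\<lambda>x. h x *\<^sub>R f x) (at x) v)" for v
    by (rule Ck_on_cong[OF assms(1)]) (simp add: frechet_derivative_at[OF der, symmetric])
  then show ?case
    using der by (auto simp: differentiable_def)
qed

lemma Ck_on_linear_compose:
  fixes l :: "'b::euclidean_space \<Rightarrow> 'c::euclidean_space"
  assumes "open S" "bounded_linear l" "Ck_on k S f"
  shows "Ck_on k S (\<lambda>x. l (f x))"
  using assms(3)
proof (induction k arbitrary: f)
  case 0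
  then show ?case using bounded_linear.continuous_on[OF assms(2)] by auto
next
  case (Suc k)
  have der: "((\<lambda>x. l (f x)) has_derivative (\<lambda>v. l (frechet_derivative f (at x) v))) (at x)"
    if "x \<in> S" for x
    by (rule bounded_linear.has_derivative[OF assms(2)])
      (use Suc.prems that in \<open>auto simp: frechet_derivative_works[symmetric]\<close>)
  have "Ck_on k S (\<lambda>x. l (frechet_derivative f (at x) v))" for v
    using Suc.prems by (intro Suc.IH) auto
  then have "Ck_on k S (\<lambda>x. frechet_derivative (\<lambda>x. l (f x)) (at x) v)" for v
    by (rule Ck_on_cong[OF assms(1)]) (simp add: frechet_derivative_at[OF der, symmetric])
  then show ?case
    using der by (auto simp: differentiable_def)
qed

text \<open>The chain rule expresses a directional derivative of \<open>g \<circ> f\<close> as \<open>Dg\<close> at \<open>f x\<close> in a direction that moves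
  with \<open>x\<close>, while the recursion of \<open>Ck_on\<close> speaks about fixed directions. Expanding the moving direction
  in the basis gives a sum of products to which the induction hypothesis and the product rule apply.\<close>

lemma Ck_on_compose:
  fixes f :: "'a::euclidean_space \<Rightarrow> 'b::euclidean_space" and g :: "'b \<Rightarrow> 'c::euclidean_space"
  assumes "open S" "Ck_on k S f" "Ck_on k T g" "f ` S \<subseteq> T"
  shows "Ck_on k S (g \<circ> f)"
  using assms(2,3)
proof (induction k arbitrary: g)
  case 0
  then show ?case
    using assms(4) continuous_on_compose[of S f g] continuous_on_subset[of T g "f ` S"] by simp
next
  case (Suc k)
  let ?Df = "\<lambda>x. frechet_derivative f (at x)" and ?Dg = "\<lambda>y. frechet_derivative g (at y)"
  have der: "(g \<circ> f has_derivative ?Dg (f x) \<circ> ?Df x) (at x)" if "x \<in> S" for x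
    by (rule diff_chain_at)
      (use Suc.prems that assms(4) in \<open>auto simp: frechet_derivative_works[symmetric]\<close>)
  have "Ck_on k S (\<lambda>x. \<Sum>b\<in>Basis. (?Df x v \<bullet> b) *\<^sub>R ((\<lambda>y. ?Dg y b) \<circ> f) x)" for v
  proof (intro Ck_on_sum Ck_on_scaleR assms(1))
    fix b :: 'b
    show "Ck_on k S (\<lambda>x. ?Df x v \<bullet> b)"
      by (rule Ck_on_linear_compose[OF assms(1) bounded_linear_inner_left]) (use Suc.prems in simp)
    show "Ck_on k S ((\<lambda>y. ?Dg y b) \<circ> f)"
      by (rule Suc.IH) (use Suc.prems Ck_on_SucD in auto)
  qed
  moreover have "?Dg (f x) (?Df x v) = (\<Sum>b\<in>Basis. (?Df x v \<bullet> b) *\<^sub>R ?Dg (f x) b)" if "x \<in> S" for x v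
  proof -
    have "linear (?Dg (f x))"
      using Suc.prems(2) that assms(4) by (auto intro: linear_frechet_derivative)
    then have "?Dg (f x) (\<Sum>b\<in>Basis. (?Df x v \<bullet> b) *\<^sub>R b) = (\<Sum>b\<in>Basis. (?Df x v \<bullet> b) *\<^sub>R ?Dg (f x) b)"
      by (simp add: linear_sum linear_scale)
    then show ?thesis
      by (simp add: euclidean_representation)
  qed
  ultimately have "Ck_on k S (\<lambda>x. ?Dg (f x) (?Df x v))" for v
    using Ck_on_cong[OF assms(1), of k "\<lambda>x. \<Sum>b\<in>Basis. (?Df x v \<bullet> b) *\<^sub>R ((\<lambda>y. ?Dg y b) \<circ> f) x"
        "\<lambda>x. ?Dg (f x) (?Df x v)"] by simp
  then have "Ck_on k S (\<lambda>x. frechet_derivative (g \<circ> f) (at x) v)" for v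
    by (rule Ck_on_cong[OF assms(1)]) (simp add: frechet_derivative_at[OF der, symmetric])
  then show ?case
    using der unfolding Ck_on.simps differentiable_def by blast
qed

lemma smooth_on_imp_continuous_on: "smooth_on S f \<Longrightarrow> continuous_on S f"
  unfolding smooth_on_def by (blast intro: Ck_on_imp_continuous_on)

lemma smooth_on_partial: "smooth_on S f \<Longrightarrow> smooth_on S (partial i f)"
  unfolding smooth_on_def partial_def by (metis Ck_on.simps(2))

lemma smooth_on_mixed_partial: "smooth_on S f \<Longrightarrow> smooth_on S (mixed_partial I f)"
proof -
  assume "smooth_on S f"
  then have "smooth_on S (foldr partial xs f)" for xs
    by (induction xs) (auto intro: smooth_on_partial)
  then show ?thesis
    unfolding mixed_partial_def .
qed

lemma smooth_on_compose:
  assumes "open S" "smooth_on S f" "smooth_on T g" "f ` S \<subseteq> T"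
  shows "smooth_on S (g \<circ> f)"
  using assms unfolding smooth_on_def by (blast intro: Ck_on_compose)

lemma smooth_on_cong:
  assumes "open S" "smooth_on S f" "\<And>x. x \<in> S \<Longrightarrow> f x = g x"
  shows "smooth_on S g"
  using assms unfolding smooth_on_def by (blast intro: Ck_on_cong)

lemma smooth_on_subset: "smooth_on S f \<Longrightarrow> T \<subseteq> S \<Longrightarrow> smooth_on T f"
  unfolding smooth_on_def by (blast intro: Ck_on_subset)

lemma smooth_on_local:
  assumes "\<And>x. x \<in> S \<Longrightarrow> \<exists>T. open T \<and> x \<in> T \<and> smooth_on T f"
  shows "smooth_on S f"
  unfolding smooth_on_def
proof
  show "Ck_on k S f" for k
    by (rule Ck_on_local) (use assms[unfolded smooth_on_def] in blast)
qed

section \<open>Topology and smooth maps in maximal atlases\<close>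

lemma open_image_chart_preimage:
  assumes "inj_on c D" "open (c ` (D \<inter> D'))" "smooth_on (c ` (D \<inter> D')) (f \<circ> inv_into D c)" "open N"
  shows "open (c ` {p \<in> D \<inter> D'. f p \<in> N})"
proof -
  have "c ` {p \<in> D \<inter> D'. f p \<in> N} = c ` (D \<inter> D') \<inter> (f \<circ> inv_into D c) -` N"
    using assms(1) by (auto simp: inv_into_f_f)
  then show ?thesis
    using continuous_open_preimage[OF smooth_on_imp_continuous_on[OF assms(3)] assms(2,4)] by simp
qed

lemma points_eq: "points A = (\<Union>(D, c)\<in>A. D)"
proof
  show "points A \<subseteq> (\<Union>(D, c)\<in>A. D)"
    unfolding atlas_topology_def topology_generated_by_topspace by auto
  have "p \<in> points A" if "(D, c) \<in> A" "p \<in> D" for p D c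
    unfolding atlas_topology_def topology_generated_by_topspace
    by (rule UnionI[of "{p \<in> D. c p \<in> UNIV}"]) (use that open_UNIV in blast)+
  then show "(\<Union>(D, c)\<in>A. D) \<subseteq> points A" by auto
qed

lemma openin_chart_preimage:
  "(D, c) \<in> A \<Longrightarrow> open N \<Longrightarrow> openin (atlas_topology A) {p \<in> D. c p \<in> N}"
  unfolding atlas_topology_def by (intro topology_generated_by_Basis) blast

text \<open>Injectivity of the charts is what lets \<open>S\<close> be recovered, chart by chart, as the preimage of its
  coordinate images; those preimages generate the topology.\<close>

lemma openin_atlas_topologyI:
  assumes "S \<subseteq> points A" "\<And>D c. (D, c) \<in> A \<Longrightarrow> inj_on c D"
    and "\<And>D c. (D, c) \<in> A \<Longrightarrow> open (c ` (D \<inter> S))"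
  shows "openin (atlas_topology A) S"
proof -
  let ?U = "\<Union>(D, c)\<in>A. {p \<in> D. c p \<in> c ` (D \<inter> S)}"
  have sub: "S \<subseteq> ?U"
  proof
    fix p assume p: "p \<in> S"
    then obtain D c where "(D, c) \<in> A" "p \<in> D"
      using assms(1) unfolding points_eq by auto
    with p show "p \<in> ?U" by (intro UN_I[of "(D, c)"]) auto
  qed
  have "p \<in> S" if "(D, c) \<in> A" "p \<in> D" "c p \<in> c ` (D \<inter> S)" for p D c
    using that assms(2)[OF that(1)] by (auto dest: inj_onD)
  then have "?U \<subseteq> S" by auto
  with sub have "?U = S" by (intro subset_antisym)
  moreover have "openin (atlas_topology A) ?U"
    using assms(3) by (intro openin_Union) (auto intro: openin_chart_preimage)
  ultimately show ?thesis by simp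
qed

text \<open>A chart of the maximal atlas is an open map. It suffices to look at the generating sets, because an
  injective chart commutes with intersections; on a generating set the claim is continuity of a
  transition map.\<close>

lemma open_chart_image:
  assumes A: "smooth_atlas A" and S: "openin (atlas_topology A) S" and C: "(D, c) \<in> maximal_atlas A"
  shows "open (c ` (D \<inter> S))"
proof -
  have inj: "inj_on c D" and op: "open (c ` D)" and sub: "D \<subseteq> points A"
    using C by (auto simp: maximal_atlas_def)
  have "generate_topology_on {{p \<in> D. c p \<in> N} | D c N. (D, c) \<in> A \<and> open N} S"
    using S by (simp add: atlas_topology_def openin_topology_generated_by_iff)
  then show ?thesis
  proof induction
    case (Int a b)
    have "c ` (D \<inter> (a \<inter> b)) = c ` (D \<inter> a) \<inter> c ` (D \<inter> b)"
      using inj by (auto simp: inj_on_def)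
    then show ?case using Int.IH by (simp add: open_Int)
  next
    case (UN K)
    have "c ` (D \<inter> \<Union>K) = (\<Union>k\<in>K. c ` (D \<inter> k))" by auto
    then show ?case using UN.IH by (simp add: open_UN)
  next
    case (Basis s)
    then obtain D' c' N where s: "s = {p \<in> D'. c' p \<in> N}" "(D', c') \<in> A" "open N" by auto
    have "compatible (D, c) (D', c')"
      using C s(2) by (auto simp: maximal_atlas_def)
    then have "open (c ` {p \<in> D \<inter> D'. c' p \<in> N})"
      by (intro open_image_chart_preimage inj s(3)) (auto simp: compatible_def)
    moreover have "D \<inter> s = {p \<in> D \<inter> D'. c' p \<in> N}" using s(1) by auto
    ultimately show ?case by simp
  qed simp
qed

lemma chart_in_maximal_atlas: "smooth_atlas A \<Longrightarrow> C \<in> A \<Longrightarrow> C \<in> maximal_atlas A"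
  unfolding maximal_atlas_def smooth_atlas_def points_eq by (cases C) fastforce

lemma openin_maximal_chart_preimage:
  assumes A: "smooth_atlas A" and C: "(D, c) \<in> maximal_atlas A" and N: "open N"
  shows "openin (atlas_topology A) {p \<in> D. c p \<in> N}"
proof (rule openin_atlas_topologyI)
  show "{p \<in> D. c p \<in> N} \<subseteq> points A"
    using C by (auto simp: maximal_atlas_def)
  show inj: "inj_on c' D'" if "(D', c') \<in> A" for D' c'
    using A that by (auto simp: smooth_atlas_def)
  show "open (c' ` (D' \<inter> {p \<in> D. c p \<in> N}))" if C': "(D', c') \<in> A" for D' c'
  proof -
    have "compatible (D, c) (D', c')"
      using C C' by (auto simp: maximal_atlas_def)
    then have "open (c' ` {p \<in> D' \<inter> D. c p \<in> N})"
      by (intro open_image_chart_preimage inj C' N) (auto simp: compatible_def Int_commute)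
    moreover have "D' \<inter> {p \<in> D. c p \<in> N} = {p \<in> D' \<inter> D. c p \<in> N}" by auto
    ultimately show ?thesis by simp
  qed
qed

lemma openin_maximal_chart_domain:
  "smooth_atlas A \<Longrightarrow> (D, c) \<in> maximal_atlas A \<Longrightarrow> openin (atlas_topology A) D"
  using openin_maximal_chart_preimage[of A D c UNIV] by simp

lemma smooth_map_openin_preimage:
  assumes A: "smooth_atlas A" and B: "smooth_atlas B" and f: "smooth_map A B S f"
    and O: "openin (atlas_topology B) P"
  shows "openin (atlas_topology A) {p \<in> S. f p \<in> P}"
proof (rule openin_atlas_topologyI)
  have S: "openin (atlas_topology A) S" and fS: "f ` S \<subseteq> points B"
    using f by (auto simp: smooth_map_def)
  show "{p \<in> S. f p \<in> P} \<subseteq> points A"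
    using openin_subset[OF S] by auto
  show inj: "inj_on c D" if "(D, c) \<in> A" for D c
    using A that by (auto simp: smooth_atlas_def)
  show "open (c ` (D \<inter> {p \<in> S. f p \<in> P}))" if C: "(D, c) \<in> A" for D c
  proof -
    have "open (c ` {p \<in> D \<inter> {p \<in> S. f p \<in> D'}. (c' \<circ> f) p \<in> c' ` (D' \<inter> P)})"
      if C': "(D', c') \<in> B" for D' c'
    proof (rule open_image_chart_preimage[OF inj[OF C]])
      have eq: "D \<inter> {p \<in> S. f p \<in> D'} = {p \<in> S \<inter> D. f p \<in> D'}" by auto
      show "open (c ` (D \<inter> {p \<in> S. f p \<in> D'}))"
        and "smooth_on (c ` (D \<inter> {p \<in> S. f p \<in> D'})) (c' \<circ> f \<circ> inv_into D c)"
        using f C C' unfolding eq smooth_map_def by (fastforce simp: Let_def)+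
      show "open (c' ` (D' \<inter> P))"
        by (rule open_chart_image[OF B O chart_in_maximal_atlas[OF B C']])
    qed
    then have "open (\<Union>(D', c')\<in>B. c ` {p \<in> D \<inter> {p \<in> S. f p \<in> D'}. (c' \<circ> f) p \<in> c' ` (D' \<inter> P)})"
      by auto
    moreover have "(\<Union>(D', c')\<in>B. c ` {p \<in> D \<inter> {p \<in> S. f p \<in> D'}. (c' \<circ> f) p \<in> c' ` (D' \<inter> P)})
        = c ` (D \<inter> {p \<in> S. f p \<in> P})" (is "?L = ?R")
    proof
      have "f p \<in> P" if "(D', c') \<in> B" "f p \<in> D'" "c' (f p) \<in> c' ` (D' \<inter> P)" for D' c' p
        using that B by (auto simp: smooth_atlas_def inj_on_def) blast
      then show "?L \<subseteq> ?R" by auto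
      show "?R \<subseteq> ?L"
        using fS unfolding points_eq by fastforce
    qed
    ultimately show ?thesis by simp
  qed
qed

text \<open>Near each point the coordinate expression in charts of the maximal atlases factors as
  transition map, coordinate expression in charts of the atlases, transition map.\<close>

lemma smooth_map_in_maximal_charts:
  assumes A: "smooth_atlas A" and B: "smooth_atlas B" and f: "smooth_map A B S f"
    and C: "(D, c) \<in> maximal_atlas A" and C': "(D', c') \<in> maximal_atlas B"
  shows "smooth_on (c ` {p \<in> S \<inter> D. f p \<in> D'}) (c' \<circ> f \<circ> inv_into D c)"
proof (rule smooth_on_local)
  fix z assume "z \<in> c ` {p \<in> S \<inter> D. f p \<in> D'}"
  then obtain p where p: "p \<in> S" "p \<in> D" "f p \<in> D'" "z = c p" by auto
  have inj: "inj_on c D" and inj': "inj_on c' D'"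
    using C C' by (auto simp: maximal_atlas_def)
  have fS: "f ` S \<subseteq> points B" and S: "openin (atlas_topology A) S"
    using f by (auto simp: smooth_map_def)
  obtain D1 c1 where C1: "(D1, c1) \<in> A" "p \<in> D1"
    using openin_subset[OF S] p(1) unfolding points_eq by auto
  obtain D2 c2 where C2: "(D2, c2) \<in> B" "f p \<in> D2"
    using fS p(1) unfolding points_eq by auto
  have inj1: "inj_on c1 D1" and inj2: "inj_on c2 D2"
    using A B C1 C2 by (auto simp: smooth_atlas_def)
  \<comment> \<open>\<open>T\<close> is the part of the domain on which the factorisation through the charts \<open>c1\<close>, \<open>c2\<close> makes sense.\<close>
  define T where "T = D \<inter> ({p \<in> S. f p \<in> D' \<inter> D2} \<inter> D1)"
  have open_T: "open (c ` T)"
    unfolding T_def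
    by (intro open_chart_image[OF A _ C] openin_Int smooth_map_openin_preimage[OF A B f]
        openin_maximal_chart_domain[OF A chart_in_maximal_atlas[OF A C1(1)]]
        openin_maximal_chart_domain[OF B C']
        openin_maximal_chart_domain[OF B chart_in_maximal_atlas[OF B C2(1)]])
  have s1: "smooth_on (c ` T) (c1 \<circ> inv_into D c)"
  proof (rule smooth_on_subset)
    show "smooth_on (c ` (D \<inter> D1)) (c1 \<circ> inv_into D c)"
      using C C1(1) by (auto simp: maximal_atlas_def compatible_def)
  qed (auto simp: T_def)
  have s2: "smooth_on (c1 ` {p \<in> S \<inter> D1. f p \<in> D2}) (c2 \<circ> f \<circ> inv_into D1 c1)"
    using f C1(1) C2(1) by (fastforce simp: smooth_map_def Let_def)
  have s3: "smooth_on (c2 ` (D' \<inter> D2)) (c' \<circ> inv_into D2 c2)"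
    using C' C2(1) by (auto simp: maximal_atlas_def compatible_def)
  have s12: "smooth_on (c ` T) ((c2 \<circ> f \<circ> inv_into D1 c1) \<circ> (c1 \<circ> inv_into D c))"
    by (rule smooth_on_compose[OF open_T s1 s2]) (use inj in \<open>auto simp: T_def\<close>)
  have "smooth_on (c ` T) ((c' \<circ> inv_into D2 c2) \<circ> ((c2 \<circ> f \<circ> inv_into D1 c1) \<circ> (c1 \<circ> inv_into D c)))"
    by (rule smooth_on_compose[OF open_T s12 s3]) (use inj inj1 in \<open>auto simp: T_def\<close>)
  then have "smooth_on (c ` T) (c' \<circ> f \<circ> inv_into D c)"
    by (rule smooth_on_cong[OF open_T]) (use inj inj1 inj2 in \<open>auto simp: T_def\<close>)
  then show "\<exists>T. open T \<and> z \<in> T \<and> smooth_on T (c' \<circ> f \<circ> inv_into D c)"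
    using open_T p C1 C2 by (intro exI[of _ "c ` T"]) (auto simp: T_def)
qed

lemma smooth_map_restrict:
  assumes A: "smooth_atlas A" and B: "smooth_atlas B" and f: "smooth_map A B S f"
    and T: "openin (atlas_topology A) T" "T \<subseteq> S"
  shows "smooth_map A B T f"
  unfolding smooth_map_def Let_def
proof (intro conjI ballI T(1), goal_cases)
  case 1
  then show ?case using f T(2) by (auto simp: smooth_map_def)
next
  case (2 C)
  obtain D c where C: "C = (D, c)" by fastforce
  have CA: "(D, c) \<in> A" using 2 C by simp
  have "open (c ` {p \<in> T \<inter> D. f p \<in> D'}) \<and> smooth_on (c ` {p \<in> T \<inter> D. f p \<in> D'}) (c' \<circ> f \<circ> inv_into D c)"
    if C': "(D', c') \<in> B" for D' c'
  proof
    have "openin (atlas_topology A) (T \<inter> {p \<in> S. f p \<in> D'})"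
      by (intro openin_Int T(1) smooth_map_openin_preimage[OF A B f]
        openin_maximal_chart_domain[OF B chart_in_maximal_atlas[OF B C']])
    from open_chart_image[OF A this chart_in_maximal_atlas[OF A CA]]
    have "open (c ` (D \<inter> (T \<inter> {p \<in> S. f p \<in> D'})))" .
    moreover have "D \<inter> (T \<inter> {p \<in> S. f p \<in> D'}) = {p \<in> T \<inter> D. f p \<in> D'}" using T(2) by auto
    ultimately show "open (c ` {p \<in> T \<inter> D. f p \<in> D'})" by simp
    have "smooth_on (c ` {p \<in> S \<inter> D. f p \<in> D'}) (c' \<circ> f \<circ> inv_into D c)"
      using f CA C' by (fastforce simp: smooth_map_def Let_def)
    then show "smooth_on (c ` {p \<in> T \<inter> D. f p \<in> D'}) (c' \<circ> f \<circ> inv_into D c)"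
      by (rule smooth_on_subset) (use T(2) in auto)
  qed
  then show ?case unfolding C by auto
qed

section \<open>Continuity of the jet prolongation\<close>

lemma jet_self_mem: "local_section F U \<phi> \<Longrightarrow> x \<in> U \<Longrightarrow> (U, \<phi>) \<in> snd (jet R F \<phi> x)"
  by (simp add: jet_def same_jet_def)

text \<open>A jet is a set of sections, and it determines the value of its representatives because each of
  them belongs to it.\<close>

lemma jet_eq_imp_value_eq:
  assumes "local_section F U \<phi>" "x \<in> U" "jet R F \<phi> x = jet R F \<psi> y"
  shows "x = y" "\<phi> x = \<psi> x"
proof -
  show xy: "x = y" using assms(3) by (simp add: jet_def)
  show "\<phi> x = \<psi> x"
    using jet_self_mem[OF assms(1,2), of R] unfolding assms(3) by (simp add: jet_def same_jet_def xy)
qed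

lemma jet_mem_chart_domain_iff:
  fixes R :: "'r::finite itself"
  assumes "local_section F U \<phi>" "x \<in> U"
  shows "jet R F \<phi> x \<in> fst (jet_chart F K :: (_, (_, _, 'r) jet_coords) chart) \<longleftrightarrow> \<phi> x \<in> fst (fst K)"
proof
  assume "jet R F \<phi> x \<in> fst (jet_chart F K :: (_, (_, _, 'r) jet_coords) chart)"
  then obtain V \<psi> y where "jet R F \<phi> x = jet TYPE('r) F \<psi> y" "\<psi> y \<in> fst (fst K)"
    by (auto simp: jet_chart_def)
  moreover have "jet TYPE('r) F \<psi> y = jet R F \<psi> y"
    by (simp only: jet_def)
  ultimately show "\<phi> x \<in> fst (fst K)"
    using jet_eq_imp_value_eq[OF assms, of R \<psi> y] by simp
next
  assume "\<phi> x \<in> fst (fst K)"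
  then show "jet R F \<phi> x \<in> fst (jet_chart F K :: (_, (_, _, 'r) jet_coords) chart)"
    using assms by (auto simp: jet_chart_def jet_def)
qed

text \<open>The jet chart evaluates a representative selected by \<open>SOME\<close>; the chosen section has the same partial
  derivatives as \<open>\<phi>\<close>, so \<open>\<phi>\<close> itself may be used to compute jet coordinates.\<close>

lemma jet_chart_jet:
  fixes R :: "'r::finite itself" and F :: "('q, 'e, 'n::finite, 'm::finite) fibred"
  assumes "local_section F U \<phi>" "x \<in> U" "K \<in> fibred_charts F" "\<phi> x \<in> fst (fst K)"
  shows "snd (jet_chart F K :: (_, ('n, 'm, 'r) jet_coords) chart) (jet R F \<phi> x)
    = (snd (snd K) x, \<chi> \<alpha> I. section_partial K (exponent I) \<alpha> \<phi> x)"
proof -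
  define s where "s = (SOME s. s \<in> snd (jet R F \<phi> x))"
  have "s \<in> snd (jet R F \<phi> x)"
    unfolding s_def by (rule someI) (rule jet_self_mem[OF assms(1,2)])
  then have "same_jet CARD('r) F x \<phi> (snd s)"
    by (auto simp: jet_def)
  then have "section_partial K (exponent I) \<alpha> (snd s) x = section_partial K (exponent I) \<alpha> \<phi> x"
    for \<alpha> and I :: "('n, 'r) multi_index"
    using assms(3,4) exponent[of I] by (auto simp: same_jet_def)
  moreover have "fst (jet R F \<phi> x) = x"
    by (simp add: jet_def)
  ultimately show ?thesis
    by (simp add: jet_chart_def Let_def s_def[symmetric])
qed

lemma continuous_on_section_mixed_partial:
  fixes F :: "('q, 'e, 'n::finite, 'm::finite) fibred"
  assumes F: "fibred_manifold F" and \<phi>: "local_section F U \<phi>"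
    and K: "((D, c), (D0, c0)) \<in> fibred_charts F"
  shows "continuous_on (c0 ` {x \<in> U \<inter> D0. \<phi> x \<in> D})
    (mixed_partial I (\<lambda>y. snd (c (\<phi> (inv_into D0 c0 y))) $ \<alpha>))"
proof (intro smooth_on_imp_continuous_on smooth_on_mixed_partial)
  let ?S = "c0 ` {x \<in> U \<inter> D0. \<phi> x \<in> D}"
  have A: "smooth_atlas (base F)" and B: "smooth_atlas (total F)"
    and C: "(D, c) \<in> maximal_atlas (total F)" and C0: "(D0, c0) \<in> maximal_atlas (base F)"
    and sm: "smooth_map (base F) (total F) U \<phi>"
    using F \<phi> K by (auto simp: fibred_manifold_def smooth_manifold_def fibred_charts_def local_section_def)
  have "open (c0 ` (D0 \<inter> {x \<in> U. \<phi> x \<in> D}))"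
    by (intro open_chart_image[OF A _ C0] smooth_map_openin_preimage[OF A B sm]
        openin_maximal_chart_domain[OF B C])
  moreover have "D0 \<inter> {x \<in> U. \<phi> x \<in> D} = {x \<in> U \<inter> D0. \<phi> x \<in> D}" by auto
  ultimately have op: "open ?S" by simp
  have l: "bounded_linear (\<lambda>w :: (real^'n) \<times> (real^'m). snd w $ \<alpha>)"
    by (intro bounded_linear_intros bounded_linear_vec_nth bounded_linear_compose[OF bounded_linear_vec_nth bounded_linear_snd])
  show "smooth_on ?S (\<lambda>y. snd (c (\<phi> (inv_into D0 c0 y))) $ \<alpha>)"
    using smooth_map_in_maximal_charts[OF A B sm C0 C] Ck_on_linear_compose[OF op l]
    unfolding smooth_on_def by (fastforce simp: o_def)
qed

text \<open>The topology is generated by the preimages of open sets under jet charts. For such a generator the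
  preimage is described in base coordinates by the continuous function \<open>u\<close> that collects the base
  point and the partial derivatives of \<open>\<phi>\<close>.\<close>

lemma openin_jet_preimage:
  fixes R :: "'r::finite itself" and F :: "('q, 'e, 'n::finite, 'm::finite) fibred"
  assumes F: "fibred_manifold F" and \<phi>: "local_section F U \<phi>"
    and W: "openin (jet_topology R F) W"
  shows "openin (base_topology F) {x \<in> U. jet R F \<phi> x \<in> W}"
proof -
  have A: "smooth_atlas (base F)" and B: "smooth_atlas (total F)"
    and sm: "smooth_map (base F) (total F) U \<phi>"
    using F \<phi> by (auto simp: fibred_manifold_def smooth_manifold_def local_section_def)
  have U: "openin (base_topology F) U"
    using sm by (simp add: smooth_map_def)
  have "generate_topology_on {{p \<in> D. c p \<in> N} | D c N. (D, c) \<in> jet_bundle R F \<and> open N} W"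
    using W by (simp add: atlas_topology_def openin_topology_generated_by_iff)
  then show ?thesis
  proof induction
    case (Int a b)
    have "{x \<in> U. jet R F \<phi> x \<in> a \<inter> b} = {x \<in> U. jet R F \<phi> x \<in> a} \<inter> {x \<in> U. jet R F \<phi> x \<in> b}"
      by auto
    then show ?case using Int by auto
  next
    case (UN \<K>)
    have "{x \<in> U. jet R F \<phi> x \<in> \<Union>\<K>} = (\<Union>k\<in>\<K>. {x \<in> U. jet R F \<phi> x \<in> k})" by auto
    then show ?case using UN by auto
  next
    case (Basis s)
    then obtain E e N where Ee: "(E, e) \<in> jet_bundle R F" and N: "open N" and sE: "s = {p \<in> E. e p \<in> N}"
      by auto
    from Ee obtain K where K: "K \<in> fibred_charts F"
      and Ke: "(jet_chart F K :: (_, ('n, 'm, 'r) jet_coords) chart) = (E, e)"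
      unfolding jet_bundle_def by auto
    have s: "s = {p \<in> fst (jet_chart F K :: (_, ('n, 'm, 'r) jet_coords) chart). snd (jet_chart F K :: (_, ('n, 'm, 'r) jet_coords) chart) p \<in> N}"
      by (simp add: sE Ke)
    obtain D c D0 c0 where K_eq: "K = ((D, c), (D0, c0))" by (metis prod.exhaust)
    have C: "(D, c) \<in> maximal_atlas (total F)" and C0: "(D0, c0) \<in> maximal_atlas (base F)"
      using K by (auto simp: fibred_charts_def K_eq)
    define u where "u = (\<lambda>y. (y, \<chi> \<alpha> (I :: ('n, 'r) multi_index).
      mixed_partial (exponent I) (\<lambda>y. snd (c (\<phi> (inv_into D0 c0 y))) $ \<alpha>) y))"
    have "openin (base_topology F) {x \<in> U. \<phi> x \<in> D}"
      by (intro smooth_map_openin_preimage[OF A B sm] openin_maximal_chart_domain[OF B C])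
    from open_chart_image[OF A this C0]
    have "open (c0 ` (D0 \<inter> {x \<in> U. \<phi> x \<in> D}))" .
    moreover have "D0 \<inter> {x \<in> U. \<phi> x \<in> D} = {x \<in> U \<inter> D0. \<phi> x \<in> D}" by auto
    moreover have "continuous_on (c0 ` {x \<in> U \<inter> D0. \<phi> x \<in> D}) u"
      unfolding u_def
      by (intro continuous_on_Pair continuous_on_id continuous_on_vec_lambda
          continuous_on_section_mixed_partial[OF F \<phi> K[unfolded K_eq]])
    ultimately have "open (c0 ` {x \<in> U \<inter> D0. \<phi> x \<in> D} \<inter> u -` N)" (is "open ?M")
      using continuous_open_preimage[OF _ _ N] by simp
    then have "openin (base_topology F) {x \<in> D0. c0 x \<in> ?M}"
      by (rule openin_maximal_chart_preimage[OF A C0])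
    moreover have "{x \<in> U. jet R F \<phi> x \<in> s} = {x \<in> D0. c0 x \<in> ?M}"
    proof -
      \<comment> \<open>A fibred chart lies over the domain of its base chart, so restricting to \<open>D0\<close> loses no points.\<close>
      have base: "x \<in> D0" if "x \<in> U" "\<phi> x \<in> D" for x
        using that K \<phi> by (fastforce simp: K_eq fibred_charts_def local_section_def)
      have "jet R F \<phi> x \<in> s \<longleftrightarrow> \<phi> x \<in> D \<and> u (c0 x) \<in> N" if "x \<in> U" for x
        using jet_mem_chart_domain_iff[OF \<phi> that, of R K] jet_chart_jet[OF \<phi> that K, of R]
        by (auto simp: s u_def K_eq section_partial_def)
      moreover have "inj_on c0 D0"
        using C0 by (auto simp: maximal_atlas_def)
      ultimately show ?thesis
        using base by (auto simp: inj_on_def)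
    qed
    ultimately show ?case by simp
  qed simp
qed

lemma local_section_restrict:
  assumes "fibred_manifold F" "local_section F U \<phi>" "openin (base_topology F) V" "V \<subseteq> U"
  shows "local_section F V \<phi>"
  using assms smooth_map_restrict[of "base F" "total F" U \<phi> V]
  by (auto simp: local_section_def fibred_manifold_def smooth_manifold_def)

section \<open>Transforming solutions\<close>

theorem theorem12p11:
  fixes F :: "('q, 'e, 'n::finite, 'm::finite) fibred"
    and F' :: "('p, 'd, 'n, 'm) fibred"
    and R :: "'r::finite itself"
    and \<E> \<U> :: "('q, 'e) jet set"
    and \<E>' \<U>' :: "('p, 'd) jet set"
    and \<Phi> :: "('q, 'e) jet \<Rightarrow> ('p, 'd) jet"
    and U :: "'q set"
    and \<phi> :: "'q \<Rightarrow> 'e"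
  assumes "fibred_manifold F" and "fibred_manifold F'"
    and "regular_pde R F \<E>"
    and "hodograph_contact R F F' \<U> \<U>' \<Phi>"
    and "\<E>' = \<Phi> ` (\<E> \<inter> \<U>)" and "regular_pde R F' \<E>'"
    and "solution R F \<E> U \<phi>"
    and "jet R F \<phi> ` U \<subseteq> \<U>"
    and "\<And>x. x \<in> U \<Longrightarrow> \<exists>V. openin (base_topology F) V \<and> x \<in> V \<and> V \<subseteq> U \<and>
           transverse (jet_bundle R F') (base F') fst (\<Phi> ` jet R F \<phi> ` V)"
  shows "\<forall>x\<in>U. \<exists>V U' \<phi>'. openin (base_topology F) V \<and> x \<in> V \<and> V \<subseteq> U \<and>
           solution R F' \<E>' U' \<phi>' \<and> \<Phi> ` jet R F \<phi> ` V = jet R F' \<phi>' ` U'"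
proof
  fix x assume x: "x \<in> U"
  have \<phi>: "local_section F U \<phi>" and sol: "jet R F \<phi> ` U \<subseteq> \<E>"
    using assms(7) by (auto simp: solution_def)
  have "jet R F \<phi> x \<in> \<U>"
    using assms(8) x by auto
  then obtain W D \<Phi>0 where W: "openin (jet_topology R F) W" "jet R F \<phi> x \<in> W"
    and \<Phi>0: "hodograph_type F F' D \<Phi>0" and pr: "hodograph_prolongation R F F' D \<Phi>0 W \<Phi>"
    using assms(4) unfolding hodograph_contact_def by metis
  \<comment> \<open>Shrinking before \<open>\<phi>'\<close> is chosen keeps all later jets inside \<open>W\<close>; shrinking afterwards would require
    cutting down the domain of \<open>\<phi>'\<close> as well and proving that it stays open.\<close>
  define U1 where "U1 = {y \<in> U. jet R F \<phi> y \<in> W}"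
  have U1: "openin (base_topology F) U1" "U1 \<subseteq> U" "x \<in> U1"
    unfolding U1_def using openin_jet_preimage[OF assms(1) \<phi> W(1)] x W(2) by auto
  have \<phi>1: "local_section F U1 \<phi>"
    by (rule local_section_restrict[OF assms(1) \<phi> U1(1,2)])
  obtain V1 where V1: "openin (base_topology F) V1" "x \<in> V1" "V1 \<subseteq> U1" "\<phi> ` V1 \<subseteq> D"
    "transverse (total F') (base F') (proj F') (\<Phi>0 ` \<phi> ` V1)"
    using pr \<phi>1 U1(3) W(2) unfolding hodograph_prolongation_def by meson
  have "local_section F V1 \<phi>"
    by (rule local_section_restrict[OF assms(1) \<phi>1 V1(1,3)])
  then obtain V U' \<phi>' where V: "openin (base_topology F) V" "x \<in> V" "V \<subseteq> V1"
    and \<phi>': "local_section F' U' \<phi>'" and im: "\<Phi>0 ` \<phi> ` V = \<phi>' ` U'"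
    using \<Phi>0 V1(2,4,5) unfolding hodograph_type_def by meson
  have VU: "V \<subseteq> U" "\<phi> ` V \<subseteq> D"
    using V V1 U1 by auto
  have \<Phi>_jet: "\<Phi> (jet R F \<phi> y) = jet R F' \<phi>' (proj F' (\<Phi>0 (\<phi> y)))" if y: "y \<in> V" for y
  proof -
    have "y \<in> U" "jet R F \<phi> y \<in> W"
      using y V(3) V1(3) by (auto simp: U1_def)
    with pr \<phi> V(1) y VU \<phi>' im show ?thesis
      unfolding hodograph_prolongation_def by meson
  qed
  \<comment> \<open>The transformed base points fill the whole domain of \<open>\<phi>'\<close>, not just a part of it.\<close>
  have "(\<lambda>y. proj F' (\<Phi>0 (\<phi> y))) ` V = proj F' ` \<phi>' ` U'"
    by (simp add: im[symmetric] image_image)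
  also have "\<dots> = U'"
    using \<phi>' by (force simp: local_section_def)
  finally have jets: "\<Phi> ` jet R F \<phi> ` V = jet R F' \<phi>' ` U'"
    using \<Phi>_jet by (force simp: image_image)
  have "\<Phi> ` jet R F \<phi> ` V \<subseteq> \<E>'"
    using VU(1) sol assms(8) unfolding assms(5) by blast
  then have "solution R F' \<E>' U' \<phi>'"
    using \<phi>' jets by (simp add: solution_def)
  with V VU jets show "\<exists>V U' \<phi>'. openin (base_topology F) V \<and> x \<in> V \<and> V \<subseteq> U \<and>
      solution R F' \<E>' U' \<phi>' \<and> \<Phi> ` jet R F \<phi> ` V = jet R F' \<phi>' ` U'"
    by blast
qed

end
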